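(* Let $F$ be an imaginary quadratic field with ring of integers $\mathcal{O}_F$, and let $A$ be a positive definite $2\times 2$ Hermitian matrix with complex entries (a positive definite binary Hermitian form). Then $\#\operatorname{Min}(A) \leq 12$.
   Context: Fix a complex embedding $F \hookrightarrow \mathbb{C}$, so that $\mathcal{O}_F^2 \subset \mathbb{C}^2$. For a $2\times 2$ Hermitian matrix $A$ and $x \in \mathbb{C}^2$, write $A[x] = \bar{x}^t A x$. For positive definite $A$, the minimum of $A$ is $\min(A) = \inf_{v \in \mathcal{O}_F^2 \setminus \{0\}} A[v]$ (which is positive), and a vector $v \in \mathcal{O}_F^2\setminus\{0\}$ is a minimal vector of $A$ if $A[v] = \min(A)$. The set $\operatorname{Min}(A)$ of minimal vectors is defined with the convention that, since $v$ is minimal if and only if $-v$ is, exactly one representative of each pair $\{\pm v\}$ is included in $\operatorname{Min}(A)$. *)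

theory Defs
  imports "HOL-Analysis.Analysis" "HOL-Computational_Algebra.Polynomial"
begin

definition imag_quad_field :: "int \<Rightarrow> complex set" where
  "imag_quad_field d =
     {of_real (of_rat a) + of_real (of_rat b) * \<i> * of_real (sqrt (of_int d)) | a b. True}"

definition algebraic_integer :: "complex \<Rightarrow> bool" where
  "algebraic_integer z \<longleftrightarrow>
     (\<exists>p :: int poly. lead_coeff p = 1 \<and> poly (map_poly of_int p) z = 0)"

definition ring_of_integers :: "complex set \<Rightarrow> complex set" where
  "ring_of_integers F = {z \<in> F. algebraic_integer z}"

definition hermitian2 :: "complex^2^2 \<Rightarrow> bool" where
  "hermitian2 A \<longleftrightarrow> (\<forall>i j. A $ i $ j = cnj (A $ j $ i))"

definition herm_eval :: "complex^2^2 \<Rightarrow> complex^2 \<Rightarrow> complex" where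
  "herm_eval A x = (\<Sum>i\<in>UNIV. \<Sum>j\<in>UNIV. cnj (x $ i) * A $ i $ j * x $ j)"

definition pos_def2 :: "complex^2^2 \<Rightarrow> bool" where
  "pos_def2 A \<longleftrightarrow> hermitian2 A \<and> (\<forall>x. x \<noteq> 0 \<longrightarrow> herm_eval A x \<in> \<real> \<and> Re (herm_eval A x) > 0)"

definition lattice_nonzero :: "complex set \<Rightarrow> (complex^2) set" where
  "lattice_nonzero OF = {v. (\<forall>i. v $ i \<in> OF) \<and> v \<noteq> 0}"

definition herm_min :: "complex set \<Rightarrow> complex^2^2 \<Rightarrow> real" where
  "herm_min OF A = Inf ((\<lambda>v. Re (herm_eval A v)) ` lattice_nonzero OF)"

definition minimal_vectors :: "complex set \<Rightarrow> complex^2^2 \<Rightarrow> (complex^2) set" where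
  "minimal_vectors OF A = {v \<in> lattice_nonzero OF. Re (herm_eval A v) = herm_min OF A}"

(* Min(A): a set containing exactly one representative of each pair {v, -v} of minimal vectors *)
definition is_Min_set :: "complex set \<Rightarrow> complex^2^2 \<Rightarrow> (complex^2) set \<Rightarrow> bool" where
  "is_Min_set OF A S \<longleftrightarrow> S \<subseteq> minimal_vectors OF A \<and>
     (\<forall>v \<in> minimal_vectors OF A. (v \<in> S) \<noteq> (-v \<in> S))"

end

theory Submission
  imports Defs "HOL-Library.Z2"
begin

text \<open>Write \<open>L\<close> for the lattice of integral vectors, of rank 4 over the integers, \<open>B\<close> for the real
  part of the Hermitian form and \<open>m\<close> for the minimum. Reduction maps the minimal vectors, taken up to
  sign, injectively to \<open>L / 2L\<close>, a group of order 16. If minimal vectors \<open>u\<close>, \<open>v\<close>, \<open>w\<close> satisfy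
  \<open>w \<equiv> u + v\<close> modulo \<open>2L\<close>, then \<open>w = \<plusminus> u \<plusminus> v\<close> and \<open>\<bar>2 B u v\<bar> = m\<close>. Hence the seven nonzero classes of a
  subgroup of order 8 cannot all be represented: for minimal vectors \<open>u\<close>, \<open>v\<close>, \<open>w\<close> generating it and
  \<open>x = \<plusminus> v \<plusminus> w\<close>, the number \<open>2 B u x\<close> would be \<open>\<plusminus> m\<close> but also \<open>\<plusminus> m \<plusminus> m\<close>. If 13 classes were
  represented, such a subgroup could be found by choosing generators greedily, since at most 3
  classes have to be avoided.\<close>

section \<open>Minimal vectors modulo twice a lattice\<close>

text \<open>Here \<open>c\<close> models reduction modulo \<open>2L\<close>: on \<open>L\<close> it
  is additive with kernel inside \<open>2L\<close>. Both conditions are restricted to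
  \<open>L\<close>, so the values of \<open>c\<close> elsewhere can be arbitrary.\<close>

locale lattice_mod2 =
  fixes L :: "'a::ab_group_add set" and B :: "'a \<Rightarrow> 'a \<Rightarrow> real" and m :: real
    and c :: "'a \<Rightarrow> 'v::{ab_group_add,finite}"
  assumes add_closed: "u \<in> L \<Longrightarrow> v \<in> L \<Longrightarrow> u + v \<in> L"
    and uminus_closed: "u \<in> L \<Longrightarrow> - u \<in> L"
    and B_add: "B (u + v) w = B u w + B v w"
    and B_sym: "B u v = B v u"
    and m_pos: "0 < m"
    and m_le: "v \<in> L \<Longrightarrow> v \<noteq> 0 \<Longrightarrow> m \<le> B v v"
    and c_add: "u \<in> L \<Longrightarrow> v \<in> L \<Longrightarrow> c (u + v) = c u + c v"
    and c_zeroD: "u \<in> L \<Longrightarrow> c u = 0 \<Longrightarrow> \<exists>w\<in>L. u = w + w"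
    and double_zero: "(x::'v) + x = 0"
begin

definition M :: "'a set" where "M = {v \<in> L. B v v = m}"

lemma M_L: "v \<in> M \<Longrightarrow> v \<in> L" and M_B: "v \<in> M \<Longrightarrow> B v v = m"
  by (auto simp: M_def)

lemma B_add_right: "B w (u + v) = B w u + B w v"
  by (metis B_add B_sym)

lemma B_zero [simp]: "B 0 w = 0" "B w 0 = 0"
  using B_add[of 0 0 w] B_sym[of w 0] by auto

lemma B_minus [simp]: "B (- u) w = - B u w" "B w (- u) = - B w u"
  using B_add[of u "- u" w] B_add_right[of w u "- u"] by auto

lemma B_diff_right: "B w (u - v) = B w u - B w v"
  using B_add_right[of w u "- v"] by simp

lemma c_uminus:
  assumes u: "u \<in> L"
  shows "c (- u) = c u"
proof -
  have "0 \<in> L" using add_closed[OF u uminus_closed[OF u]] by simp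
  then have "c 0 = 0" using c_add[of 0 0] by simp
  then have "c u + c (- u) = c u + c u"
    using c_add[OF u uminus_closed[OF u]] by (simp add: double_zero)
  then show ?thesis by simp
qed

text \<open>The vector is \<open>w + w\<close> with \<open>w\<close> nonzero in \<open>L\<close>,
  and doubling multiplies the norm by 4.\<close>

lemma half_bound:
  assumes "u \<in> L" "c u = 0" "u \<noteq> 0"
  shows "4 * m \<le> B u u"
proof -
  obtain w where w: "w \<in> L" "u = w + w" using c_zeroD assms by blast
  with assms have "w \<noteq> 0" by auto
  with m_le w have "m \<le> B w w" by blast
  then show ?thesis by (simp add: w B_add B_add_right)
qed

text \<open>By the parallelogram law the norms of \<open>u + v\<close> and \<open>u - v\<close> add
  up to \<open>4 * m\<close>. Both vectors lie in \<open>2L\<close>, so if neither vanished the sum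
  would be at least \<open>8 * m\<close>.\<close>

lemma c_eqD:
  assumes "u \<in> M" "v \<in> M" "c u = c v"
  shows "u = v \<or> u = - v"
proof (rule ccontr)
  assume "\<not> ?thesis"
  \<comment> \<open>Differences are kept in the form \<open>u + - v\<close> so that the additivity
    rules for \<open>B\<close> and \<open>c\<close> apply.\<close>
  then have nz: "u + v \<noteq> 0" "u + - v \<noteq> 0" by (auto simp: add_eq_0_iff2)
  have L: "u \<in> L" "v \<in> L" using assms M_L by auto
  have "4 * m \<le> B (u + v) (u + v)" "4 * m \<le> B (u + - v) (u + - v)"
    using half_bound nz L assms(3)
    by (simp_all add: add_closed uminus_closed c_add c_uminus double_zero del: add_uminus_conv_diff)
  then show False
    using M_B assms m_pos B_sym[of u v]
    by (simp add: B_add B_add_right del: add_uminus_conv_diff)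
qed

text \<open>The four vectors \<open>u \<plusminus> v \<plusminus> w\<close> lie in \<open>2L\<close> and their norms add up to
  \<open>12 m\<close>, so one of them vanishes.\<close>
lemma c_lineD:
  assumes "u \<in> M" "v \<in> M" "w \<in> M" "c w = c u + c v"
  shows "w \<in> {u + v, u + - v, - u + v, - u + - v}" "\<bar>2 * B u v\<bar> = m"
proof -
  have L: "u \<in> L" "v \<in> L" "w \<in> L" using assms M_L by auto
  have c0: "c u + c v + (c u + c v) = 0" by (rule double_zero)
  show cases: "w \<in> {u + v, u + - v, - u + v, - u + - v}"
  proof (rule ccontr)
    assume "\<not> ?thesis"
    then have nz: "u + v + w \<noteq> 0" "u + v + - w \<noteq> 0" "u + - v + w \<noteq> 0" "u + - v + - w \<noteq> 0"
      by (auto simp: add_eq_0_iff)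
    have "c (u + v + w) = 0" "c (u + v + - w) = 0" "c (u + - v + w) = 0" "c (u + - v + - w) = 0"
      by (simp_all only: add_closed uminus_closed c_add c_uminus L assms(4) c0)
    then have "4 * m \<le> B (u + v + w) (u + v + w)" "4 * m \<le> B (u + v + - w) (u + v + - w)"
      "4 * m \<le> B (u + - v + w) (u + - v + w)" "4 * m \<le> B (u + - v + - w) (u + - v + - w)"
      using half_bound nz L by (meson add_closed uminus_closed)+
    then show False using M_B[OF assms(1)] M_B[OF assms(2)] M_B[OF assms(3)] m_pos
        B_sym[of u v] B_sym[of u w] B_sym[of v w]
      by (simp only: B_add B_add_right B_minus)
  qed
  have m: "B w w = m" "B u u = m" "B v v = m" using assms by (simp_all add: M_B)
  \<comment> \<open>For \<open>w = \<plusminus> u \<plusminus> v\<close> the norm is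
    \<open>2 * m\<close> plus or minus \<open>2 * B u v\<close>, and it has to equal
    \<open>m\<close>.\<close>
  have "2 * B u v = m \<or> 2 * B u v = - m"
    using cases m
    by (elim insertE emptyE; simp only: B_add B_add_right B_minus B_sym[of v u]; linarith)
  then show "\<bar>2 * B u v\<bar> = m" using m_pos by auto
qed

lemma no_full_plane:
  assumes "p \<in> c ` M" "q \<in> c ` M" "r \<in> c ` M" "p + q \<in> c ` M" "p + r \<in> c ` M" "q + r \<in> c ` M"
    "p + (q + r) \<in> c ` M"
  shows False
proof -
  obtain u v w x where M: "u \<in> M" "v \<in> M" "w \<in> M" "x \<in> M"
    and c: "p = c u" "q = c v" "r = c w" "c x = c v + c w"
    using assms by fastforce
  have "\<bar>2 * B u v\<bar> = m" "\<bar>2 * B u w\<bar> = m" "\<bar>2 * B u x\<bar> = m"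
    using assms c c_lineD(2) M by (metis imageE)+
  moreover have "x \<in> {v + w, v + - w, - v + w, - v + - w}"
    using c_lineD(1) M c by blast
  \<comment> \<open>A signed sum of \<open>2 * B u v\<close> and \<open>2 * B u w\<close> is 0 or
    \<plusminus> \<open>2 * m\<close>, never \<plusminus> \<open>m\<close>.\<close>
  ultimately show False
    using m_pos by (auto simp: B_add_right B_diff_right)
qed

section \<open>Avoiding a few classes in a group of exponent two\<close>

lemma greedy_plane:
  fixes N :: "'v set"
  assumes "card N \<le> 3" "12 < CARD('v)"
  obtains p q r where "p \<notin> N" "q \<notin> N" "r \<notin> N" "p + q \<notin> N" "p + r \<notin> N" "q + r \<notin> N" "p + (q + r) \<notin> N"
proof -
  have pick: "\<exists>x. x \<notin> X" if "card X \<le> 12" for X :: "'v set"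
    using that assms(2) by (metis UNIV_I not_le subsetI top.extremum_uniqueI)
  \<comment> \<open>Every \<open>x\<close> is its own negative.\<close>
  have sum_notin: "x + y \<notin> N" if "y \<notin> (+) x ` N" for x y
    using that double_zero[of x]
    by (metis add.assoc add_0 image_eqI)
  have im: "card ((+) x ` N) \<le> 3" for x
    using assms(1) card_image_le[of N] by (meson finite le_trans)
  \<comment> \<open>The choice of \<open>p\<close> avoids at most 3 classes, that of
    \<open>q\<close> at most 6, and that of \<open>r\<close> at most 12: the translates of
    \<open>N\<close> by 0, \<open>p\<close>, \<open>q\<close> and \<open>p + q\<close>.\<close>
  obtain p where p: "p \<notin> N" using pick[of N] assms(1) by auto
  obtain q where q: "q \<notin> N \<union> (+) p ` N"
    using pick[of "N \<union> (+) p ` N"] card_Un_le[of N "(+) p ` N"] im[of p] assms(1) by auto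
  let ?U = "N \<union> (+) p ` N" and ?W = "(+) q ` N \<union> (+) (p + q) ` N"
  have "card ?U \<le> 6" "card ?W \<le> 6"
    using card_Un_le[of N "(+) p ` N"] card_Un_le[of "(+) q ` N" "(+) (p + q) ` N"]
      im[of p] im[of q] im[of "p + q"] assms(1) by auto
  then obtain r where r: "r \<notin> ?U \<union> ?W"
    using pick[of "?U \<union> ?W"] card_Un_le[of ?U ?W] by auto
  have "p + q \<notin> N" "p + r \<notin> N" "q + r \<notin> N" "p + q + r \<notin> N"
    by (rule sum_notin, use q r in blast)+
  then show thesis using that[of p q r] p q r by (metis UnI1 add.assoc)
qed

theorem card_M_half_le:
  assumes "CARD('v) = 16" "S \<subseteq> M" "\<And>v. v \<in> S \<Longrightarrow> - v \<notin> S"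
  shows "finite S" "card S \<le> 12"
proof -
  have inj: "inj_on c S"
    using c_eqD assms(2,3) by (intro inj_onI) blast
  then show "finite S" using finite_imageD finite by blast
  show "card S \<le> 12"
  proof (rule ccontr)
    assume "\<not> ?thesis"
    then have "13 \<le> card (c ` S)" using card_image[OF inj] by simp
    also have "\<dots> \<le> card (c ` M)" using assms(2) by (intro card_mono) auto
    \<comment> \<open>At most 16 - 13 = 3 classes contain no minimal vector; these are the ones to
      avoid.\<close>
    finally have "card (- c ` M) \<le> 3" using assms(1) by (simp add: Compl_eq_Diff_UNIV card_Diff_subset)
    then show False
      using greedy_plane[of "- c ` M"] no_full_plane assms(1) by simp blast
  qed
qed

end

section \<open>Integers of an imaginary quadratic field\<close>

lemma UNIV_bit: "(UNIV :: bit set) = {0, 1}"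
  using bit.exhaust by auto

text \<open>Classes modulo \<open>2L\<close> will be encoded as four bits, and the locale requires a
  finite type of classes.\<close>

instance bit :: finite
  by standard (simp add: UNIV_bit)

lemma card_bit: "CARD(bit) = 2"
  by (simp add: UNIV_bit)

section \<open>Integrality in terms of trace and norm\<close>

lemma algebraic_integer_iff: "algebraic_integer z \<longleftrightarrow> algebraic_int z"
  by (auto simp: algebraic_integer_def algebraic_int_altdef_ipoly)

text \<open>Gauss' lemma for a quadratic polynomial: dividing out the content leaves a polynomial that
  divides the monic one over the integers.\<close>
lemma algebraic_int_quadratic_dvd:
  fixes z :: complex and l m n :: int
  assumes z: "algebraic_int z" "z \<notin> \<real>" and l: "l \<noteq> 0"
    and root: "of_int l * z\<^sup>2 + of_int m * z + of_int n = 0"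
  shows "l dvd m" "l dvd n"
proof -
  define ev where "ev = (\<lambda>p::int poly. poly (map_poly of_int p) z)"
  have ev_mult: "ev (p * q) = ev p * ev q" for p q
  proof -
    have "map_poly complex_of_int (p * q) = map_poly of_int p * map_poly of_int q"
      by (intro poly_eqI) (simp add: coeff_map_poly coeff_mult)
    then show ?thesis by (simp add: ev_def)
  qed
  have ev_add: "ev (p + q) = ev p + ev q" for p q
  proof -
    have "map_poly complex_of_int (p + q) = map_poly of_int p + map_poly of_int q"
      by (intro poly_eqI) (simp add: coeff_map_poly)
    then show ?thesis by (simp add: ev_def)
  qed
  obtain p where p: "ev p = 0" "lead_coeff p = 1"
    using z(1) by (auto simp: ev_def algebraic_int_altdef_ipoly)
  define g where "g = [:n, m, l:]"
  define h where "h = primitive_part g"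
  have g: "degree g = 2" "lead_coeff g = l" "g \<noteq> 0" using l by (auto simp: g_def)
  have gh: "smult (content g) h = g" by (simp add: h_def)
  have h: "h \<noteq> 0" "degree h = 2" "content h = 1"
    using g by (auto simp: h_def)
  have "ev g = 0" using root by (simp add: ev_def g_def map_poly_pCons algebra_simps power2_eq_square)
  moreover have "g = [:content g:] * h" by (simp add: gh)
  ultimately have "ev [:content g:] * ev h = 0" by (metis ev_mult)
  then have h0: "ev h = 0" using g by (auto simp: ev_def map_poly_pCons)
  \<comment> \<open>Since \<open>h\<close> need not be monic, dividing \<open>p\<close> by it over
    the integers requires a scaling factor \<open>a\<close>.\<close>
  define r where "r = pseudo_mod p h"
  obtain a q where aq: "a \<noteq> 0" "smult a p = h * q + r" and "r = 0 \<or> degree r < degree h"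
    using pseudo_mod[OF h(1), of p] r_def by blast
  then have "degree r < 2" using h(2) by auto
  have "ev ([:a:] * p) = ev (h * q + r)" using aq by simp
  then have r0: "ev r = 0" by (simp only: ev_mult ev_add p h0) simp
  obtain r0 r1 where r: "r = [:r0, r1:]"
  proof
    show "r = [:coeff r 0, coeff r 1:]"
      using \<open>degree r < 2\<close>
      by (intro poly_eqI) (auto simp: coeff_pCons coeff_eq_0 split: nat.split)
  qed
  have eq: "of_int r0 + z * of_int r1 = 0" using r0 by (simp add: ev_def r map_poly_pCons)
  \<comment> \<open>A nonzero polynomial of degree below 2 with integer coefficients has no nonreal
    root, so the remainder vanishes.\<close>
  have "Im z \<noteq> 0" using z(2) by (simp add: complex_is_Real_iff)
  moreover have "Im z * of_int r1 = 0" using arg_cong[OF eq, of Im] by simp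
  ultimately have "r1 = 0" by simp
  with eq have "r = 0" by (simp add: r)
  then have apq: "smult a p = h * q" using aq by simp
  \<comment> \<open>Comparing contents, with \<open>h\<close> primitive, shows that \<open>a\<close>
    divides \<open>q\<close>; hence \<open>h\<close> divides \<open>p\<close> itself.\<close>
  then have "normalize a * content p = content q"
    by (metis content_smult content_mult h(3) mult_1)
  then have "normalize a dvd content q" by (metis dvd_triv_left)
  then have "a dvd content q" by simp
  then obtain q' where "q = [:a:] * q'" by (meson const_poly_dvd_iff_dvd_content dvdE)
  then have "smult a p = smult a (h * q')" using apq by simp
  then have "p = h * q'" using aq(1) by (simp add: smult_cancel)
  \<comment> \<open>As \<open>p\<close> is monic, the leading coefficient of \<open>h\<close> is a
    unit, so \<open>l\<close> divides the content of \<open>g\<close>.\<close>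
  then have "lead_coeff h * lead_coeff q' = 1" using p(2) by (simp add: lead_coeff_mult)
  then have "lead_coeff h dvd 1" by (metis dvd_triv_left)
  moreover have "l = content g * lead_coeff h" using g gh by (metis lead_coeff_smult)
  ultimately have "l dvd content g" by simp
  moreover have "content g dvd coeff g 0" "content g dvd coeff g 1" by (rule content_dvd_coeff)+
  ultimately show "l dvd m" "l dvd n" by (auto simp: g_def dest: dvd_trans)
qed

lemma imag_quad_field_iff:
  assumes "d > 0"
  shows "z \<in> imag_quad_field d \<longleftrightarrow> Re z \<in> \<rat> \<and> Im z / sqrt d \<in> \<rat>"
proof
  assume "z \<in> imag_quad_field d"
  then show "Re z \<in> \<rat> \<and> Im z / sqrt d \<in> \<rat>"
    using assms by (auto simp: imag_quad_field_def)
next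
  assume "Re z \<in> \<rat> \<and> Im z / sqrt d \<in> \<rat>"
  then obtain a b where ab: "Re z = of_rat a" "Im z / sqrt d = of_rat b"
    by (auto elim!: Rats_cases)
  then have "Im z = of_rat b * sqrt d" using assms by (simp add: field_simps)
  with ab have "z = of_real (of_rat a) + of_real (of_rat b) * \<i> * of_real (sqrt (of_int d))"
    by (simp add: complex_eq_iff)
  then show "z \<in> imag_quad_field d" unfolding imag_quad_field_def by blast
qed

lemma common_denominator:
  fixes x y :: real
  assumes "x \<in> \<rat>" "y \<in> \<rat>"
  obtains k m n :: int where "k \<noteq> 0" "k * x = m" "k * y = n"
proof -
  obtain a b where x: "b > 0" "x = of_int a / of_int b" using assms(1) by (rule Rats_cases')
  obtain c e where y: "e > 0" "y = of_int c / of_int e" using assms(2) by (rule Rats_cases')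
  show thesis by (rule that[of "b * e" "a * e" "b * c"]) (use x y in auto)
qed

text \<open>A nonreal \<open>z\<close> is a root of the quadratic with trace \<open>2 * Re z\<close>
  and norm \<open>(cmod z)\<^sup>2\<close>, to which Gauss' lemma applies; a real \<open>z\<close>
  in the field is rational. As \<open>d\<close> need not be squarefree, this replaces the usual
  description by residues modulo 4.\<close>

lemma ring_of_integers_iff:
  assumes d: "d > 0"
  shows "z \<in> ring_of_integers (imag_quad_field d) \<longleftrightarrow>
    z \<in> imag_quad_field d \<and> 2 * Re z \<in> \<int> \<and> (cmod z)\<^sup>2 \<in> \<int>"
proof (intro iffI conjI; (elim conjE)?)
  assume z: "z \<in> ring_of_integers (imag_quad_field d)"
  then show F: "z \<in> imag_quad_field d" by (simp add: ring_of_integers_def)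
  have alg: "algebraic_int z" using z by (simp add: ring_of_integers_def algebraic_integer_iff)
  have "2 * Re z \<in> \<int> \<and> (cmod z)\<^sup>2 \<in> \<int>"
  proof (cases "z \<in> \<real>")
    case True
    then have zr: "z = of_real (Re z)" by simp
    moreover have "Re z \<in> \<rat>" using F imag_quad_field_iff[OF d] by simp
    ultimately have "z \<in> \<rat>" by (metis Rats_complex_of_real_iff)
    then have "z \<in> \<int>" using alg rational_algebraic_int_is_int by blast
    then show ?thesis by (auto elim!: Ints_cases)
  next
    case False
    have rat: "Re z \<in> \<rat>" "Im z / sqrt d \<in> \<rat>" using F imag_quad_field_iff[OF d] by auto
    have "(cmod z)\<^sup>2 = (Re z)\<^sup>2 + (Im z / sqrt d)\<^sup>2 * d"
      using d by (simp add: cmod_power2 power_divide)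
    also have "\<dots> \<in> \<rat>" using rat by auto
    finally have "(cmod z)\<^sup>2 \<in> \<rat>" .
    moreover have "2 * Re z \<in> \<rat>" using rat by auto
    ultimately obtain k m n :: int where k: "k \<noteq> 0" "k * (2 * Re z) = m" "k * (cmod z)\<^sup>2 = n"
      by (metis common_denominator)
    have "z\<^sup>2 - of_real (2 * Re z) * z + of_real ((cmod z)\<^sup>2) = 0"
      by (simp add: complex_eq_iff cmod_power2) (simp add: power2_eq_square)
    then have "of_int k * (z\<^sup>2 - of_real (2 * Re z) * z + of_real ((cmod z)\<^sup>2)) = 0" by simp
    then have "of_int k * z\<^sup>2 - of_real (k * (2 * Re z)) * z + of_real (k * (cmod z)\<^sup>2) = 0"
      by (simp add: algebra_simps)
    then have "of_int k * z\<^sup>2 + of_int (- m) * z + of_int n = 0" unfolding k by simp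
    then have "k dvd - m" "k dvd n" using algebraic_int_quadratic_dvd alg False k(1) by blast+
    then obtain m' n' where "m = k * m'" "n = k * n'" by (auto elim!: dvdE)
    with k have "2 * Re z = of_int m'" "(cmod z)\<^sup>2 = of_int n'" by auto
    then show ?thesis by simp
  qed
  then show "2 * Re z \<in> \<int>" "(cmod z)\<^sup>2 \<in> \<int>" by auto
next
  assume F: "z \<in> imag_quad_field d" and "2 * Re z \<in> \<int>" "(cmod z)\<^sup>2 \<in> \<int>"
  then obtain t n where tn: "2 * Re z = of_int t" "(cmod z)\<^sup>2 = of_int n" by (auto elim!: Ints_cases)
  have "z\<^sup>2 - of_real (2 * Re z) * z + of_real ((cmod z)\<^sup>2) = 0"
    by (simp add: complex_eq_iff cmod_power2) (simp add: power2_eq_square)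
  then have "poly (map_poly of_int [:n, - t, 1:]) z = 0"
    unfolding tn by (simp add: map_poly_pCons algebra_simps power2_eq_square)
  then have "algebraic_integer z"
    unfolding algebraic_integer_def by (intro exI[of _ "[:n, - t, 1:]"]) auto
  with F show "z \<in> ring_of_integers (imag_quad_field d)" by (simp add: ring_of_integers_def)
qed

section \<open>The ring of integers as a lattice of rank two\<close>

context
  fixes d :: int and R :: "complex set"
  assumes d: "d > 0"
  defines "R \<equiv> ring_of_integers (imag_quad_field d)"
begin

lemma R_iff: "z \<in> R \<longleftrightarrow> Re z \<in> \<rat> \<and> Im z / sqrt d \<in> \<rat> \<and> 2 * Re z \<in> \<int> \<and> (cmod z)\<^sup>2 \<in> \<int>"
  unfolding R_def using ring_of_integers_iff imag_quad_field_iff d by blast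

lemma R_scale:
  assumes "z \<in> R"
  shows "of_int k * z \<in> R"
proof -
  have "of_int k * (2 * Re z) \<in> \<int>" "of_int k * (Im z / sqrt d) \<in> \<rat>"
    using assms unfolding R_iff by (blast intro: Ints_mult Rats_mult Ints_of_int Rats_of_int)+
  then show ?thesis using assms by (simp add: R_iff norm_mult power_mult_distrib mult.left_commute)
qed

text \<open>Only the norm needs work: its cross term is half of
  \<open>2 * Re z * (2 * Re w) + x\<close> with \<open>x = 4 * Im z * Im w\<close>. Being rational
  with an integral square, \<open>x\<close> is an integer, and a parity argument makes the sum
  even.\<close>

lemma R_add:
  assumes "z \<in> R" "w \<in> R"
  shows "z + w \<in> R"
proof -
  obtain s t m n where st: "2 * Re z = of_int s" "2 * Re w = of_int t"
    and mn: "(cmod z)\<^sup>2 = of_int m" "(cmod w)\<^sup>2 = of_int n"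
    using assms by (auto simp: R_iff elim!: Ints_cases)
  define x where "x = 4 * Im z * Im w"
  have z2: "4 * (Im z)\<^sup>2 = of_int (4 * m - s\<^sup>2)" and w2: "4 * (Im w)\<^sup>2 = of_int (4 * n - t\<^sup>2)"
    by (simp_all flip: st mn add: cmod_power2 power_mult_distrib)
  have "x = 4 * (Im z / sqrt d) * (Im w / sqrt d) * d" using d by (simp add: x_def)
  also have "\<dots> \<in> \<rat>" using assms by (auto simp: R_iff simp del: times_divide_eq_right times_divide_eq_left)
  finally have "x \<in> \<rat>" .
  have "x\<^sup>2 = (4 * (Im z)\<^sup>2) * (4 * (Im w)\<^sup>2)" by (simp add: x_def power2_eq_square)
  also have "\<dots> = of_int ((4 * m - s\<^sup>2) * (4 * n - t\<^sup>2))" by (simp only: z2 w2 of_int_mult)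
  finally have x2: "x\<^sup>2 = of_int ((4 * m - s\<^sup>2) * (4 * n - t\<^sup>2))" .
  have "algebraic_int (x\<^sup>2)" unfolding x2 by (rule int_imp_algebraic_int) simp
  then have "algebraic_int x"
    by (rule algebraic_int_root[where p = "monom 1 2"]) (auto simp: poly_monom degree_monom_eq)
  with \<open>x \<in> \<rat>\<close> obtain e where e: "x = of_int e"
    using rational_algebraic_int_is_int by (blast elim: Ints_cases)
  have "e\<^sup>2 = (4 * m - s\<^sup>2) * (4 * n - t\<^sup>2)" using x2 unfolding e by (metis of_int_eq_iff of_int_power)
  then have "even (e\<^sup>2) \<longleftrightarrow> even ((4 * m - s\<^sup>2) * (4 * n - t\<^sup>2))" by simp
  \<comment> \<open>Modulo 2 the factors \<open>4 * m - s\<^sup>2\<close> and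
    \<open>4 * n - t\<^sup>2\<close> agree with \<open>s\<close> and \<open>t\<close>, so
    \<open>e\<close> has the parity of \<open>s * t\<close>.\<close>
  then have "even (s * t + e)" by auto
  then obtain k where k: "s * t + e = 2 * k" by blast
  have "4 * (Re z * Re w + Im z * Im w) = (2 * Re z) * (2 * Re w) + x" by (simp add: x_def)
  also have "\<dots> = of_int (s * t + e)" by (simp add: st e)
  also have "\<dots> = 2 * of_int k" by (simp add: k)
  finally have k': "2 * (Re z * Re w + Im z * Im w) = of_int k" by linarith
  have "(cmod (z + w))\<^sup>2 = (cmod z)\<^sup>2 + (cmod w)\<^sup>2 + 2 * (Re z * Re w + Im z * Im w)"
    unfolding cmod_power2 by (simp add: algebra_simps power2_eq_square)
  also have "\<dots> = of_int (m + n + k)" by (simp only: mn k' of_int_add)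
  finally have "(cmod (z + w))\<^sup>2 \<in> \<int>" by (metis Ints_of_int)
  moreover have "Im (z + w) / sqrt d \<in> \<rat>"
    using assms by (simp add: R_iff add_divide_distrib)
  moreover have "2 * Re (z + w) \<in> \<int>" using assms by (simp add: R_iff distrib_left)
  ultimately show ?thesis using assms by (simp add: R_iff)
qed

lemma R_uminus: "z \<in> R \<Longrightarrow> - z \<in> R"
  using R_scale[of z "- 1"] by simp

lemma one_in_R: "1 \<in> R"
  by (simp add: R_iff)

lemma R_real_Ints:
  assumes "z \<in> R" "Im z = 0"
  shows "Re z \<in> \<int>"
proof -
  have zr: "z = of_real (Re z)" using assms(2) by (simp add: complex_eq_iff)
  moreover have "Re z \<in> \<rat>" using assms(1) by (simp add: R_iff)
  ultimately have "z \<in> \<rat>" by (metis Rats_complex_of_real_iff)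
  moreover have "algebraic_int z"
    using assms(1) by (simp add: R_def ring_of_integers_def algebraic_integer_iff)
  ultimately have "z \<in> \<int>" using rational_algebraic_int_is_int by blast
  then show ?thesis by (auto elim!: Ints_cases)
qed

text \<open>The generator is an element of least positive imaginary part; it exists since \<open>4 (Im z)\<^sup>2\<close> is a
  natural number for every integer \<open>z\<close> of the field.\<close>
lemma R_basis:
  obtains \<omega> where "\<omega> \<in> R" "Im \<omega> > 0"
    "\<And>z. z \<in> R \<Longrightarrow> \<exists>a b :: int. z = of_int a + of_int b * \<omega>"
proof -
  let ?P = "\<lambda>k::nat. \<exists>z\<in>R. Im z > 0 \<and> 4 * (Im z)\<^sup>2 = k"
  have nat: "\<exists>k::nat. 4 * (Im z)\<^sup>2 = k" if "z \<in> R" for z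
  proof -
    have "4 * (cmod z)\<^sup>2 - (2 * Re z)\<^sup>2 \<in> \<int>"
      using that unfolding R_iff by (blast intro: Ints_diff Ints_mult Ints_power Ints_numeral)
    then have "4 * (Im z)\<^sup>2 \<in> \<int>" by (simp add: cmod_power2 power_mult_distrib)
    then have "4 * (Im z)\<^sup>2 \<in> \<nat>" by (simp add: Nats_altdef2)
    then show ?thesis by (auto elim!: Nats_cases)
  qed
  define k where "k = (LEAST k. ?P k)"
  \<comment> \<open>This element shows that some integer has positive imaginary part, so the minimum
    exists.\<close>
  have "\<i> * sqrt d \<in> R" using d by (simp add: R_iff norm_mult)
  moreover have "Im (\<i> * sqrt d) > 0" using d by simp
  ultimately have "\<exists>k. ?P k" using nat by blast
  then have "?P k" unfolding k_def by (rule LeastI_ex)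
  then obtain \<omega> where \<omega>: "\<omega> \<in> R" "Im \<omega> > 0" "4 * (Im \<omega>)\<^sup>2 = k" by blast
  have least: "Im \<omega> \<le> Im z" if z: "z \<in> R" "Im z > 0" for z
  proof -
    obtain j :: nat where j: "4 * (Im z)\<^sup>2 = j" using nat z by blast
    then have "k \<le> j" unfolding k_def using z by (intro Least_le) blast
    then have "(Im \<omega>)\<^sup>2 \<le> (Im z)\<^sup>2" using \<omega>(3) j by linarith
    then show ?thesis using z by (simp add: power2_le_iff_abs_le)
  qed
  show thesis
  proof (rule that[OF \<omega>(1,2)])
    fix z assume z: "z \<in> R"
    \<comment> \<open>Subtracting this multiple of \<open>\<omega>\<close> brings the imaginary part
      into the range from 0 to below \<open>Im \<omega>\<close>; minimality then forces it to be
      0.\<close>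
    define b where "b = \<lfloor>Im z / Im \<omega>\<rfloor>"
    define w where "w = z + of_int (- b) * \<omega>"
    have w: "w \<in> R" unfolding w_def using z R_add R_scale \<omega> by blast
    have "of_int b \<le> Im z / Im \<omega>" "Im z / Im \<omega> < of_int b + 1" unfolding b_def by linarith+
    then have "0 \<le> Im w" "Im w < Im \<omega>" using \<omega>(2) by (simp_all add: w_def field_simps)
    with least[OF w] have "Im w = 0" by linarith
    then obtain a where "Re w = of_int a" using R_real_Ints[OF w] by (auto elim: Ints_cases)
    with \<open>Im w = 0\<close> have "w = of_int a" by (simp add: complex_eq_iff)
    then have "z = of_int a + of_int b * \<omega>" by (simp add: w_def algebra_simps)
    then show "\<exists>a b :: int. z = of_int a + of_int b * \<omega>" by blast
  qed
qed

text \<open>The map takes the coordinates in the basis 1, \<open>\<omega>\<close> modulo 2, with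
  kernel in \<open>2R\<close>.\<close>

lemma R_parity:
  obtains \<psi> :: "complex \<Rightarrow> bit \<times> bit"
  where "\<And>z w. z \<in> R \<Longrightarrow> w \<in> R \<Longrightarrow> \<psi> (z + w) = \<psi> z + \<psi> w"
    "\<And>z. z \<in> R \<Longrightarrow> \<psi> z = 0 \<Longrightarrow> \<exists>w\<in>R. z = w + w"
proof -
  obtain \<omega> where \<omega>: "\<omega> \<in> R" "Im \<omega> > 0"
    and basis: "\<And>z. z \<in> R \<Longrightarrow> \<exists>a b :: int. z = of_int a + of_int b * \<omega>"
    using R_basis by metis
  define coord where "coord z = (SOME p. z = of_int (fst p) + of_int (snd p) * \<omega>)" for z
  have unique: "a = a' \<and> b = b'"
    if eq: "of_int a + of_int b * \<omega> = of_int a' + of_int b' * \<omega>" for a b a' b' :: int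
  proof -
    have "of_int b * Im \<omega> = of_int b' * Im \<omega>" using arg_cong[OF eq, of Im] by simp
    with \<omega>(2) have "b = b'" by simp
    with eq show ?thesis by simp
  qed
  have coord: "z = of_int (fst (coord z)) + of_int (snd (coord z)) * \<omega>" if "z \<in> R" for z
    unfolding coord_def by (rule someI_ex) (use basis[OF that] in auto)
  define \<psi> :: "complex \<Rightarrow> bit \<times> bit" where "\<psi> z = (of_int (fst (coord z)), of_int (snd (coord z)))" for z
  show thesis
  proof
    fix z w assume zw: "z \<in> R" "w \<in> R"
    have "of_int (fst (coord (z + w))) + of_int (snd (coord (z + w))) * \<omega> = z + w"
      using coord[OF R_add[OF zw]] by simp
    also have "\<dots> = of_int (fst (coord z) + fst (coord w)) + of_int (snd (coord z) + snd (coord w)) * \<omega>"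
      using coord[OF zw(1)] coord[OF zw(2)] by (simp add: algebra_simps)
    finally show "\<psi> (z + w) = \<psi> z + \<psi> w"
      using unique by (metis \<psi>_def add_Pair of_int_add)
  next
    have bit: "even n" if "(of_int n :: bit) = 0" for n :: int
      using that by (metis even_of_int_iff even_zero)
    fix z assume z: "z \<in> R" "\<psi> z = 0"
    then have "even (fst (coord z))" "even (snd (coord z))"
      by (auto simp: \<psi>_def zero_prod_def intro: bit)
    then obtain a b where "fst (coord z) = 2 * a" "snd (coord z) = 2 * b" by (auto elim!: evenE)
    \<comment> \<open>The factor 1 is kept so that both summands are integer multiples of elements
      of \<open>R\<close>.\<close>
    with coord[OF z(1)] have "z = (of_int a * 1 + of_int b * \<omega>) + (of_int a * 1 + of_int b * \<omega>)"
      by (simp add: algebra_simps)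
    then show "\<exists>w\<in>R. z = w + w" using R_add R_scale one_in_R \<omega>(1) by blast
  qed
qed

end

section \<open>Binary Hermitian forms\<close>

theorem theorem4p1:
  fixes d :: int and A :: "complex^2^2" and S :: "(complex^2) set"
  assumes "d > 0"
    and "pos_def2 A"
    and "is_Min_set (ring_of_integers (imag_quad_field d)) A S"
  shows "finite S \<and> card S \<le> 12"
proof (cases "S = {}")
  case False
  define R where "R = ring_of_integers (imag_quad_field d)"
  define L where "L = {v :: complex^2. \<forall>i. v $ i \<in> R}"
  define m where "m = herm_min R A"
  \<comment> \<open>This sesquilinear form polarizes \<open>herm_eval A\<close>; its real part plays
    the role of \<open>B\<close>.\<close>
  define H where "H u v = (\<Sum>i\<in>UNIV. \<Sum>j\<in>UNIV. cnj (u $ i) * A $ i $ j * v $ j)" for u v :: "complex^2"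
  obtain \<psi> :: "complex \<Rightarrow> bit \<times> bit"
    where \<psi>: "\<And>z w. z \<in> R \<Longrightarrow> w \<in> R \<Longrightarrow> \<psi> (z + w) = \<psi> z + \<psi> w"
      "\<And>z. z \<in> R \<Longrightarrow> \<psi> z = 0 \<Longrightarrow> \<exists>w\<in>R. z = w + w"
    unfolding R_def by (rule R_parity[OF assms(1)]) blast
  have H_eval: "herm_eval A v = H v v" for v
    by (simp add: herm_eval_def H_def)
  have pos: "Re (H v v) > 0" if "v \<noteq> 0" for v
    using assms(2) that by (simp add: pos_def2_def H_eval)
  have A: "cnj (A $ i $ j) = A $ j $ i" for i j
    using assms(2) unfolding pos_def2_def hermitian2_def by (metis complex_cnj_cnj)
  have min: "v \<in> L \<and> Re (H v v) = m \<and> v \<noteq> 0 \<and> - v \<notin> S" if "v \<in> S" for v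
    using assms(3) that
    by (auto simp: is_Min_set_def minimal_vectors_def lattice_nonzero_def L_def m_def R_def H_eval)
  have "cnj (H u v) = H v u" for u v
    unfolding H_def by (subst sum.swap) (simp add: A mult_ac)
  then have H_sym: "Re (H u v) = Re (H v u)" for u v
    by (metis cnj.simps(1))
  have m_le: "m \<le> Re (H v v)" if "v \<in> L" "v \<noteq> 0" for v
    unfolding m_def herm_min_def H_eval
  proof (rule cInf_lower)
    show "bdd_below ((\<lambda>v. Re (H v v)) ` lattice_nonzero R)"
      using pos by (auto simp: lattice_nonzero_def intro!: bdd_belowI[of _ 0] less_imp_le)
  qed (use that in \<open>auto simp: L_def lattice_nonzero_def\<close>)
  \<comment> \<open>The class of a vector records the parities of its two entries, four bits in
    all.\<close>
  interpret lattice_mod2 L "\<lambda>u v. Re (H u v)" m "\<lambda>v. (\<psi> (v $ 1), \<psi> (v $ 2))"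
  proof
    \<comment> \<open>A member of \<open>S\<close> attains the infimum, which is therefore positive;
      this is why empty \<open>S\<close> is treated separately.\<close>
    obtain v where "v \<in> S" using False by blast
    then show "0 < m" using min pos by metis
  next
    fix u v assume "u \<in> L" "v \<in> L"
    then show "u + v \<in> L"
      "(\<psi> ((u + v) $ 1), \<psi> ((u + v) $ 2)) = (\<psi> (u $ 1), \<psi> (u $ 2)) + (\<psi> (v $ 1), \<psi> (v $ 2))"
      using R_add[OF assms(1)] by (simp_all add: L_def R_def[symmetric] \<psi>(1))
  next
    fix u assume u: "u \<in> L"
    then show "- u \<in> L" using R_uminus[OF assms(1)] by (simp add: L_def R_def[symmetric])
    assume "(\<psi> (u $ 1), \<psi> (u $ 2)) = 0"
    then have "\<psi> (u $ 1) = 0" "\<psi> (u $ 2) = 0" by (simp_all add: zero_prod_def)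
    moreover have "u $ 1 \<in> R" "u $ 2 \<in> R" using u by (simp_all add: L_def)
    ultimately obtain x y where "x \<in> R" "y \<in> R" "u $ 1 = x + x" "u $ 2 = y + y"
      using \<psi>(2) by meson
    then show "\<exists>w\<in>L. u = w + w"
      by (intro bexI[of _ "vector [x, y]"]) (auto simp: L_def vec_eq_iff forall_2)
  next
    show "Re (H (u + v) w) = Re (H u w) + Re (H v w)" for u v w
      by (simp add: H_def distrib_right sum.distrib)
    show "x + x = 0" for x :: "(bit \<times> bit) \<times> (bit \<times> bit)"
      by (auto simp: prod_eq_iff)
  qed (use m_le H_sym in blast)+
  have "S \<subseteq> M" using min by (auto simp: M_def)
  moreover have "CARD((bit \<times> bit) \<times> (bit \<times> bit)) = 16" by (simp add: card_bit)
  ultimately show ?thesis using card_M_half_le[of S] min by meson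
qed simp

end
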